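(* Let $A\in\mathbb{R}^{N\times N}$, $N=nr$, be an $M$-matrix partitioned in block tridiagonal form with $n\times n$ diagonal blocks $A_1,\dots,A_r$ and off-diagonal coupling blocks of bandwidth $\beta$, and let $F\in\mathbb{R}^N$. Let $\tilde S,\tilde G$ be the reduced spike matrix and reduced right-hand side, and let $I_*,G^*$ be the identity matrix and right-hand side for the remaining (middle) components. Then the partitioned linear complementarity system consisting of $$\tilde S\tilde X\ge \tilde G,\qquad \tilde X\ge 0,\qquad (\tilde S\tilde X-\tilde G)\cdot\tilde X=0$$ and $$I_*X^*\ge G^*,\qquad X^*\ge 0,\qquad (I_*X^*-G^* )\cdot X^*=0$$ has a unique solution: there is exactly one $\tilde X$ solving the first system, and, with $G^*$ formed from this $\tilde X$, exactly one $X^*$ solving the second.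
   Context: Inequalities between vectors and matrices are entrywise and $\cdot$ is the Euclidean dot product. An $M$-matrix is a square matrix with non-positive off-diagonal entries that is invertible with entrywise non-negative inverse. Partition: $A$ is block tridiagonal with $r\times r$ blocks of size $n\times n$. Its $i$-th block row acts on $X=(x_1,\dots,x_r)$, $x_i\in\mathbb{R}^n$, by $C_i x_{i-1}+A_i x_i+B_i x_{i+1}$, with $C_1=0$, $B_r=0$ and $x_0=x_{r+1}=0$. The off-diagonal blocks have the form $$C_i=\begin{bmatrix}0&\hat C_i\\0&0\end{bmatrix},\qquad B_i=\begin{bmatrix}0&0\\ \hat B_i&0\end{bmatrix},$$ where $\hat C_i$ is a $\beta\times\beta$ lower triangular matrix, $\hat B_i$ is a $\beta\times\beta$ upper triangular matrix, and $2\beta\le n$. Spike decomposition: $D=\mathrm{diag}(A_1,\dots,A_r)$, and $S$ is the matrix with identity diagonal blocks $I_n$, block $A_i^{-1}B_i$ in position $(i,i+1)$ and block $A_i^{-1}C_i$ in position $(i,i-1)$, so $A=DS$. The vector $G=(G_1,\dots,G_r)$ is defined by $DG=F$. Reduced system: in each of the $r$ blocks take the top $\beta$ and bottom $\beta$ indices. $\tilde S$ is the submatrix of $S$ with these rows and columns, $\tilde G$ is the corresponding subvector of $G$, and $\tilde X$ is the corresponding vector of unknowns; the size is $n_{rd}=2r\beta$. (The spike blocks $A_i^{-1}C_i$, respectively $A_i^{-1}B_i$, have nonzero columns only at the bottom $\beta$, respectively top $\beta$, indices of the neighbouring block.) Remaining system: $X^*$ collects the remaining components (the middle $n-2\beta$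 indices of each block), $I_*$ is the identity matrix of size $r(n-2\beta)$, and $G^*$ is the vector whose $i$-th block is the restriction of $G_i-A_i^{-1}C_i x_{i-1}-A_i^{-1}B_i x_{i+1}$ to the middle indices. This depends only on $G$ and $\tilde X$. *)

theory Defs
  imports
    "Jordan_Normal_Form.Gauss_Jordan_Elimination"
    "Jordan_Normal_Form.DL_Submatrix"
begin

text \<open>
  Blocks and indices are counted from \<open>0\<close>. A matrix or vector with \<open>r\<close> blocks of size \<open>n\<close> is stored
  flat: position \<open>p < n\<close> of block \<open>i < r\<close> is the index \<open>i * n + p\<close>. Vectors and matrices are compared
  entrywise by the library orders \<open>\<le>\<close>, which include equality of dimensions.
\<close>

definition mat_inv :: "real mat \<Rightarrow> real mat" where
  "mat_inv A = the (mat_inverse A)"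

definition M_matrix :: "real mat \<Rightarrow> bool" where
  "M_matrix A \<longleftrightarrow> square_mat A
     \<and> (\<forall>i < dim_row A. \<forall>j < dim_row A. i \<noteq> j \<longrightarrow> A $$ (i, j) \<le> 0)
     \<and> invertible_mat A \<and> 0\<^sub>m (dim_row A) (dim_row A) \<le> mat_inv A"

definition lcp_solution :: "real mat \<Rightarrow> real vec \<Rightarrow> real vec \<Rightarrow> bool" where
  "lcp_solution M q x \<longleftrightarrow> x \<in> carrier_vec (dim_col M)
     \<and> q \<le> M *\<^sub>v x \<and> 0\<^sub>v (dim_col M) \<le> x \<and> (M *\<^sub>v x - q) \<bullet> x = 0"

definition mat_block :: "nat \<Rightarrow> real mat \<Rightarrow> nat \<Rightarrow> nat \<Rightarrow> real mat" where
  "mat_block n A i j = mat n n (\<lambda>(p, q). A $$ (i * n + p, j * n + q))"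

definition vec_block :: "nat \<Rightarrow> real vec \<Rightarrow> nat \<Rightarrow> real vec" where
  "vec_block n x i = vec n (\<lambda>p. x $ (i * n + p))"

definition lower_triangular :: "real mat \<Rightarrow> bool" where
  "lower_triangular A \<longleftrightarrow> upper_triangular (transpose_mat A)"

definition lower_coupling_form :: "nat \<Rightarrow> nat \<Rightarrow> real mat \<Rightarrow> bool" where
  "lower_coupling_form n \<beta> C \<longleftrightarrow> (\<exists>C' \<in> carrier_mat \<beta> \<beta>. lower_triangular C' \<and>
     C = four_block_mat (0\<^sub>m \<beta> (n - \<beta>))       C'
                        (0\<^sub>m (n - \<beta>) (n - \<beta>)) (0\<^sub>m (n - \<beta>) \<beta>))"

definition upper_coupling_form :: "nat \<Rightarrow> nat \<Rightarrow> real mat \<Rightarrow> bool" where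
  "upper_coupling_form n \<beta> B \<longleftrightarrow> (\<exists>B' \<in> carrier_mat \<beta> \<beta>. upper_triangular B' \<and>
     B = four_block_mat (0\<^sub>m (n - \<beta>) \<beta>) (0\<^sub>m (n - \<beta>) (n - \<beta>))
                        B'               (0\<^sub>m \<beta> (n - \<beta>)))"

definition block_tridiagonal :: "nat \<Rightarrow> nat \<Rightarrow> nat \<Rightarrow> real mat \<Rightarrow> bool" where
  "block_tridiagonal r n \<beta> A \<longleftrightarrow> A \<in> carrier_mat (r * n) (r * n) \<and> 2 * \<beta> \<le> n
     \<and> (\<forall>i < r. \<forall>j < r. Suc i < j \<or> Suc j < i \<longrightarrow> mat_block n A i j = 0\<^sub>m n n)
     \<and> (\<forall>i. Suc i < r \<longrightarrow> lower_coupling_form n \<beta> (mat_block n A (Suc i) i)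
                         \<and> upper_coupling_form n \<beta> (mat_block n A i (Suc i)))"

definition diagonal_block :: "nat \<Rightarrow> real mat \<Rightarrow> nat \<Rightarrow> real mat" where
  "diagonal_block n A i = mat_block n A i i"

text \<open>The first lower and the last upper coupling block are \<open>0\<close>; the neighbouring vector blocks
  that do not exist are therefore never used.\<close>

definition lower_coupling :: "nat \<Rightarrow> real mat \<Rightarrow> nat \<Rightarrow> real mat" where
  "lower_coupling n A i = (if i = 0 then 0\<^sub>m n n else mat_block n A i (i - 1))"

definition upper_coupling :: "nat \<Rightarrow> nat \<Rightarrow> real mat \<Rightarrow> nat \<Rightarrow> real mat" where
  "upper_coupling r n A i = (if Suc i < r then mat_block n A i (Suc i) else 0\<^sub>m n n)"

definition lower_spike :: "nat \<Rightarrow> real mat \<Rightarrow> nat \<Rightarrow> real mat" where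
  "lower_spike n A i = mat_inv (diagonal_block n A i) * lower_coupling n A i"

definition upper_spike :: "nat \<Rightarrow> nat \<Rightarrow> real mat \<Rightarrow> nat \<Rightarrow> real mat" where
  "upper_spike r n A i = mat_inv (diagonal_block n A i) * upper_coupling r n A i"

definition spike_diag :: "nat \<Rightarrow> nat \<Rightarrow> real mat \<Rightarrow> real mat" where
  "spike_diag r n A = diag_block_mat (map (diagonal_block n A) [0..<r])"

definition spike_block :: "nat \<Rightarrow> nat \<Rightarrow> real mat \<Rightarrow> nat \<Rightarrow> nat \<Rightarrow> real mat" where
  "spike_block r n A i j =
     (if i = j then 1\<^sub>m n
      else if j = Suc i then upper_spike r n A i
      else if i = Suc j then lower_spike n A i
      else 0\<^sub>m n n)"

definition spike_mat :: "nat \<Rightarrow> nat \<Rightarrow> real mat \<Rightarrow> real mat" where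
  "spike_mat r n A =
     mat (r * n) (r * n) (\<lambda>(k, l). spike_block r n A (k div n) (l div n) $$ (k mod n, l mod n))"

definition spike_rhs :: "nat \<Rightarrow> nat \<Rightarrow> real mat \<Rightarrow> real vec \<Rightarrow> real vec" where
  "spike_rhs r n A F = (THE G. G \<in> carrier_vec (r * n) \<and> spike_diag r n A *\<^sub>v G = F)"

definition reduced_indices :: "nat \<Rightarrow> nat \<Rightarrow> nat \<Rightarrow> nat set" where
  "reduced_indices r n \<beta> = {k. k < r * n \<and> (k mod n < \<beta> \<or> n - \<beta> \<le> k mod n)}"

definition middle_indices :: "nat \<Rightarrow> nat \<Rightarrow> nat \<Rightarrow> nat set" where
  "middle_indices r n \<beta> = {k. k < r * n \<and> \<beta> \<le> k mod n \<and> k mod n < n - \<beta>}"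

text \<open>The analogue for vectors of the library's \<^const>\<open>submatrix\<close>, and the vector of dimension \<open>N\<close>
  that has the entries of \<open>w\<close> at the indices in \<open>I\<close> and \<open>0\<close> elsewhere.\<close>

definition subvector :: "real vec \<Rightarrow> nat set \<Rightarrow> real vec" where
  "subvector v I = vec (card {i. i < dim_vec v \<and> i \<in> I}) (\<lambda>k. v $ pick I k)"

definition extend_vec :: "nat \<Rightarrow> nat set \<Rightarrow> real vec \<Rightarrow> real vec" where
  "extend_vec N I w = vec N (\<lambda>i. if i \<in> I then w $ card {a \<in> I. a < i} else 0)"

definition reduced_spike_mat :: "nat \<Rightarrow> nat \<Rightarrow> nat \<Rightarrow> real mat \<Rightarrow> real mat" where
  "reduced_spike_mat r n \<beta> A =
     submatrix (spike_mat r n A) (reduced_indices r n \<beta>) (reduced_indices r n \<beta>)"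

definition reduced_spike_rhs :: "nat \<Rightarrow> nat \<Rightarrow> nat \<Rightarrow> real mat \<Rightarrow> real vec \<Rightarrow> real vec" where
  "reduced_spike_rhs r n \<beta> A F = subvector (spike_rhs r n A F) (reduced_indices r n \<beta>)"

definition remaining_mat :: "nat \<Rightarrow> nat \<Rightarrow> nat \<Rightarrow> real mat" where
  "remaining_mat r n \<beta> = 1\<^sub>m (r * (n - 2 * \<beta>))"

definition remaining_block :: "nat \<Rightarrow> nat \<Rightarrow> real mat \<Rightarrow> real vec \<Rightarrow> real vec \<Rightarrow> nat \<Rightarrow> real vec" where
  "remaining_block r n A F x i =
     vec_block n (spike_rhs r n A F) i
       - lower_spike n A i *\<^sub>v vec_block n x (i - 1)
       - upper_spike r n A i *\<^sub>v vec_block n x (Suc i)"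

text \<open>The right-hand side for the middle components is formed from the reduced unknowns \<open>w\<close> alone:
  the spikes have nonzero columns only at reduced indices, so the value given to the middle
  components of the extended vector (here \<open>0\<close>) does not matter.\<close>

definition remaining_rhs :: "nat \<Rightarrow> nat \<Rightarrow> nat \<Rightarrow> real mat \<Rightarrow> real vec \<Rightarrow> real vec \<Rightarrow> real vec" where
  "remaining_rhs r n \<beta> A F w =
     (let x = extend_vec (r * n) (reduced_indices r n \<beta>) w
      in subvector (vec (r * n) (\<lambda>k. remaining_block r n A F x (k div n) $ (k mod n)))
           (middle_indices r n \<beta>))"

end

theory Submission
  imports Defs "Jordan_Normal_Form.Determinant"
begin

text \<open>
  A Z-matrix \<open>M\<close> is a nonsingular M-matrix iff \<open>M u > 0\<close> for some \<open>u > 0\<close>. For such \<open>M\<close>, comparing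
  a vector \<open>z\<close> with the multiple \<open>t u\<close> where \<open>t = min (z\<^sub>i / u\<^sub>i)\<close> shows that a vector with a negative
  entry has an index where both \<open>z\<close> and \<open>M z\<close> are negative. This gives \<open>M\<inverse> \<ge> 0\<close> and uniqueness for
  every linear complementarity problem with matrix \<open>M\<close>; a solution is the infimum of all feasible
  vectors, a fixed point of the projected Jacobi map.

  With \<open>u = A\<inverse> 1\<close> the condition passes from \<open>A\<close> to its diagonal blocks, hence \<open>A\<^sub>i\<inverse> \<ge> 0\<close>,
  then to the spike matrix, because \<open>S u = D\<inverse> 1 > 0\<close>, and finally to the principal submatrix
  of \<open>S\<close> at the reduced indices.
\<close>

section \<open>Semipositive Z-matrices\<close>

text \<open>The witness \<open>u\<close> is a parameter because one vector serves \<open>A\<close>,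
  its diagonal blocks, \<open>spike_diag\<close> and \<open>spike_mat\<close>. As a function on
  indices it restricts to submatrices by composition.\<close>

definition semipositive_by :: "nat \<Rightarrow> real mat \<Rightarrow> (nat \<Rightarrow> real) \<Rightarrow> bool" where
  "semipositive_by m M u \<longleftrightarrow> M \<in> carrier_mat m m
     \<and> (\<forall>i<m. \<forall>j<m. i \<noteq> j \<longrightarrow> M $$ (i, j) \<le> 0)
     \<and> (\<forall>i<m. 0 < u i \<and> 0 < (\<Sum>j<m. M $$ (i, j) * u j))"

lemma semipositive_byD:
  assumes "semipositive_by m M u"
  shows "M \<in> carrier_mat m m"
    and "i < m \<Longrightarrow> j < m \<Longrightarrow> i \<noteq> j \<Longrightarrow> M $$ (i, j) \<le> 0"
    and "i < m \<Longrightarrow> 0 < u i"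
    and "i < m \<Longrightarrow> 0 < (\<Sum>j<m. M $$ (i, j) * u j)"
  using assms by (auto simp: semipositive_by_def)

lemma mult_mat_vec_index_sum:
  assumes "M \<in> carrier_mat k m" "v \<in> carrier_vec m" "i < k"
  shows "(M *\<^sub>v v) $ i = (\<Sum>j<m. M $$ (i, j) * v $ j)"
  using assms by (auto simp: scalar_prod_def atLeast0LessThan intro!: sum.cong)

lemma mult_mat_index_sum:
  assumes "M \<in> carrier_mat k m" "N \<in> carrier_mat m l" "i < k" "j < l"
  shows "(M * N) $$ (i, j) = (\<Sum>q<m. M $$ (i, q) * N $$ (q, j))"
  using assms by (auto simp: scalar_prod_def atLeast0LessThan intro!: sum.cong)

text \<open>If \<open>w i\<close> were 0, the diagonal term of row \<open>i\<close> would vanish,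
  leaving only non-positive terms.\<close>

lemma nonneg_imp_pos_if_row_pos:
  fixes M :: "real mat"
  assumes "\<And>j. j < m \<Longrightarrow> j \<noteq> i \<Longrightarrow> M $$ (i, j) \<le> 0" "\<And>j. j < m \<Longrightarrow> 0 \<le> w j"
    and "0 < (\<Sum>j<m. M $$ (i, j) * w j)" "i < m"
  shows "0 < w i"
proof (rule ccontr)
  assume "\<not> 0 < w i"
  with assms(2,4) have "w i = 0" by force
  then have "(\<Sum>j<m. M $$ (i, j) * w j) \<le> 0"
    using assms(1,2) by (intro sum_nonpos) (metis lessThan_iff mult_nonpos_nonneg mult_zero_right order_refl)
  with assms(3) show False by simp
qed

lemma semipositive_diag_pos:
  assumes M: "semipositive_by m M u" and i: "i < m"
  shows "0 < M $$ (i, i)"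
proof (rule ccontr)
  assume "\<not> 0 < M $$ (i, i)"
  then have "M $$ (i, j) * u j \<le> 0" if "j < m" for j
    using semipositive_byD(2)[OF M i that] semipositive_byD(3)[OF M that]
    by (cases "i = j") (simp_all add: mult_nonpos_nonneg)
  then have "(\<Sum>j<m. M $$ (i, j) * u j) \<le> 0"
    by (intro sum_nonpos) auto
  with semipositive_byD(4)[OF M i] show False by simp
qed

text \<open>For the least quotient \<open>t\<close>, the vector z - t u is non-negative and vanishes
  at the minimizing \<open>i\<close>. Row \<open>i\<close> of M (z - t u) therefore has only
  non-positive terms, and (M z)_i is at most t (M u)_i < 0.\<close>

lemma semipositive_negative_index:
  assumes M: "semipositive_by m M u" and "k < m" "z k < 0"
  obtains i where "i < m" "z i < 0" "(\<Sum>j<m. M $$ (i, j) * z j) < 0"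
proof -
  let ?q = "\<lambda>i. z i / u i"
  define t where "t = Min (?q ` {..<m})"
  have "t \<in> ?q ` {..<m}"
    unfolding t_def using \<open>k < m\<close> by (intro Min_in) auto
  then obtain i where i: "i < m" "t = z i / u i" by auto
  have t_le: "t \<le> z j / u j" if "j < m" for j
    unfolding t_def using that by (intro Min_le) auto
  have "z k / u k < 0"
    using assms semipositive_byD(3)[OF M] by (simp add: divide_neg_pos)
  with t_le[OF \<open>k < m\<close>] have t: "t < 0" by simp
  have zi: "z i = t * u i" using i semipositive_byD(3)[OF M, of i] by simp
  have "(\<Sum>j<m. M $$ (i, j) * z j) \<le> (\<Sum>j<m. M $$ (i, j) * (t * u j))"
  proof (rule sum_mono)
    fix j assume "j \<in> {..<m}"
    then have j: "j < m" by simp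
    have "t * u j \<le> z j"
      using t_le[OF j] semipositive_byD(3)[OF M j] by (simp add: pos_le_divide_eq)
    then show "M $$ (i, j) * z j \<le> M $$ (i, j) * (t * u j)"
      using zi semipositive_byD(2)[OF M i(1) j]
      by (cases "i = j") (auto intro: mult_left_mono_neg)
  qed
  also have "\<dots> = t * (\<Sum>j<m. M $$ (i, j) * u j)"
    by (simp add: sum_distrib_left algebra_simps)
  also have "\<dots> < 0"
    using t semipositive_byD(4)[OF M i(1)] by (simp add: mult_neg_pos)
  finally show thesis
    using that[OF i(1)] zi t semipositive_byD(3)[OF M i(1)] by (simp add: mult_neg_pos)
qed

lemma semipositive_monotone:
  assumes M: "semipositive_by m M u" and "\<And>i. i < m \<Longrightarrow> 0 \<le> (\<Sum>j<m. M $$ (i, j) * z j)"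
    and "k < m"
  shows "0 \<le> z k"
proof (rule ccontr)
  assume "\<not> 0 \<le> z k"
  then obtain i where "i < m" "(\<Sum>j<m. M $$ (i, j) * z j) < 0"
    using semipositive_negative_index[OF M \<open>k < m\<close>, of z] by force
  with assms(2) show False by fastforce
qed

section \<open>Nonsingularity and the non-negative inverse\<close>

lemma semipositive_det_nonzero:
  assumes M: "semipositive_by m M u"
  shows "det M \<noteq> 0"
proof
  note C = semipositive_byD(1)[OF M]
  assume "det M = 0"
  then obtain v where v: "v \<in> carrier_vec m" "v \<noteq> 0\<^sub>v m" "M *\<^sub>v v = 0\<^sub>v m"
    using det_0_iff_vec_prod_zero_field[OF C] by auto
  have 0: "(\<Sum>j<m. M $$ (i, j) * v $ j) = 0" if "i < m" for i
    using mult_mat_vec_index_sum[OF C v(1) that] v(3) that by simp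
  \<comment> \<open>Monotonicity applied to the kernel vector and to its negative forces every entry
    to be 0.\<close>
  have "0 \<le> v $ k" "0 \<le> - v $ k" if "k < m" for k
    using semipositive_monotone[OF M _ that, of "\<lambda>j. v $ j"]
      semipositive_monotone[OF M _ that, of "\<lambda>j. - v $ j"] 0
    by (simp_all add: sum_negf)
  then have "v = 0\<^sub>v m" using v(1) by (intro eq_vecI) force+
  with v(2) show False by simp
qed

lemma mat_inv_unit:
  assumes A: "A \<in> carrier_mat m m" and U: "A \<in> Units (ring_mat TYPE(real) m ())"
  shows "A * mat_inv A = 1\<^sub>m m" "mat_inv A * A = 1\<^sub>m m" "mat_inv A \<in> carrier_mat m m"
proof -
  \<comment> \<open>Membership in \<open>Units\<close> excludes the value \<open>None\<close>, so
    \<open>the\<close> in \<open>mat_inv\<close> returns a genuine inverse.\<close>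
  obtain B where "mat_inverse A = Some B"
    using mat_inverse(1)[OF A, of "()"] U by fastforce
  then show "A * mat_inv A = 1\<^sub>m m" "mat_inv A * A = 1\<^sub>m m" "mat_inv A \<in> carrier_mat m m"
    using mat_inverse(2)[OF A] by (auto simp: mat_inv_def)
qed

lemma semipositive_mat_inv:
  assumes M: "semipositive_by m M u"
  shows "M * mat_inv M = 1\<^sub>m m" "mat_inv M * M = 1\<^sub>m m" "mat_inv M \<in> carrier_mat m m"
    and "i < m \<Longrightarrow> j < m \<Longrightarrow> 0 \<le> mat_inv M $$ (i, j)"
proof -
  note C = semipositive_byD(1)[OF M]
  note inv = mat_inv_unit[OF C det_non_zero_imp_unit[OF C semipositive_det_nonzero[OF M]]]
  show "M * mat_inv M = 1\<^sub>m m" "mat_inv M * M = 1\<^sub>m m" "mat_inv M \<in> carrier_mat m m"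
    by (fact inv)+
  assume ij: "i < m" "j < m"
  \<comment> \<open>\<open>M\<close> maps column \<open>j\<close> of its inverse to a unit vector,
    which is non-negative, so monotonicity applies to this column.\<close>
  have "(\<Sum>q<m. M $$ (k, q) * mat_inv M $$ (q, j)) = (if k = j then 1 else 0)" if "k < m" for k
    using mult_mat_index_sum[OF C inv(3) that ij(2)] inv(1) that ij(2) by simp
  then show "0 \<le> mat_inv M $$ (i, j)"
    using semipositive_monotone[OF M _ ij(1), of "\<lambda>q. mat_inv M $$ (q, j)"] by simp
qed

text \<open>The row sums form the vector w = B 1, which is non-negative with A w = 1 > 0. For the
  whole matrix this supplies the witness \<open>u\<close>; for the diagonal blocks it gives D^-1 1 >
  0.\<close>

lemma inverse_row_sum_pos:
  assumes A: "A \<in> carrier_mat m m" and B: "B \<in> carrier_mat m m" and AB: "A * B = 1\<^sub>m m"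
    and Z: "\<And>i j. i < m \<Longrightarrow> j < m \<Longrightarrow> i \<noteq> j \<Longrightarrow> A $$ (i, j) \<le> (0::real)"
    and B0: "\<And>i j. i < m \<Longrightarrow> j < m \<Longrightarrow> 0 \<le> B $$ (i, j)"
    and i: "i < m"
  shows "0 < (\<Sum>j<m. B $$ (i, j))" "(\<Sum>k<m. A $$ (i, k) * (\<Sum>j<m. B $$ (k, j))) = 1"
proof -
  have "(\<Sum>k<m. A $$ (i, k) * (\<Sum>j<m. B $$ (k, j))) = (\<Sum>j<m. \<Sum>k<m. A $$ (i, k) * B $$ (k, j))"
    by (simp add: sum_distrib_left) (rule sum.swap)
  also have "\<dots> = (\<Sum>j<m. 1\<^sub>m m $$ (i, j))"
    using mult_mat_index_sum[OF A B i] AB by (intro sum.cong) auto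
  also have "\<dots> = (\<Sum>j<m. if j = i then 1 else 0)"
    using i by (intro sum.cong) auto
  also have "\<dots> = 1" using i by simp
  finally show eq: "(\<Sum>k<m. A $$ (i, k) * (\<Sum>j<m. B $$ (k, j))) = 1" .
  show "0 < (\<Sum>j<m. B $$ (i, j))"
    using eq i Z B0
    by (intro nonneg_imp_pos_if_row_pos[of m i A "\<lambda>k. \<Sum>j<m. B $$ (k, j)"]) (auto intro: sum_nonneg)
qed

text \<open>The witness is A^-1 1. The normalization A u = 1 is kept because it turns S u into the
  row sums of the inverse diagonal blocks.\<close>

lemma M_matrix_semipositive:
  assumes "M_matrix A" and A: "A \<in> carrier_mat m m"
  obtains u where "semipositive_by m A u" "\<And>i. i < m \<Longrightarrow> (\<Sum>j<m. A $$ (i, j) * u j) = 1"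
proof -
  have Z: "A $$ (i, j) \<le> 0" if "i < m" "j < m" "i \<noteq> j" for i j
    using assms that by (auto simp: M_matrix_def)
  obtain B where B: "A * B = 1\<^sub>m (dim_row A)" "B * A = 1\<^sub>m (dim_row B)"
    using assms(1) by (auto simp: M_matrix_def invertible_mat_def inverts_mat_def)
  have dims: "dim_row B = m" "dim_col B = m"
    using B A by (metis carrier_matD index_mult_mat(2,3) index_one_mat(2,3))+
  then have "A \<in> Units (ring_mat TYPE(real) m ())"
    using A B by (auto simp: Units_def ring_mat_def intro!: bexI[of _ B])
  note inv = mat_inv_unit[OF A this]
  have nonneg: "0 \<le> mat_inv A $$ (i, j)" if "i < m" "j < m" for i j
    using assms that inv(3) by (auto simp: M_matrix_def less_eq_mat_def)
  note pos = inverse_row_sum_pos[OF A inv(3) inv(1) Z nonneg]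
  show thesis
  proof (rule that)
    show "semipositive_by m A (\<lambda>i. \<Sum>j<m. mat_inv A $$ (i, j))"
      using A Z pos by (simp add: semipositive_by_def)
  qed (use pos in auto)
qed

section \<open>Operations that preserve semipositivity\<close>

lemma semipositive_principal:
  assumes M: "semipositive_by m M u" and f: "inj_on f {..<k}" "f ` {..<k} \<subseteq> {..<m}"
  shows "semipositive_by k (mat k k (\<lambda>(i, j). M $$ (f i, f j))) (u \<circ> f)"
  unfolding semipositive_by_def
proof (intro conjI allI impI)
  fix i assume i: "i < k"
  then have fi: "f i < m" using f by auto
  show "0 < (u \<circ> f) i" using semipositive_byD(3)[OF M fi] by simp
  \<comment> \<open>The discarded columns are off-diagonal for row \<open>f i\<close>, so dropping
    their non-positive terms can only raise the sum. \<open>sum_mono2\<close> asks for non-negative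
    extra terms, hence the negated summand.\<close>
  have "(\<Sum>j<m. M $$ (f i, j) * u j) \<le> (\<Sum>j\<in>f ` {..<k}. M $$ (f i, j) * u j)"
  proof (rule sum_mono2[OF _ f(2), of "\<lambda>j. - (M $$ (f i, j) * u j)", unfolded sum_negf neg_le_iff_le])
    fix j assume "j \<in> {..<m} - f ` {..<k}"
    then have "j < m" "f i \<noteq> j" using i by auto
    then show "0 \<le> - (M $$ (f i, j) * u j)"
      using semipositive_byD(2)[OF M fi, of j] semipositive_byD(3)[OF M, of j]
      by (simp add: mult_nonpos_nonneg)
  qed auto
  also have "\<dots> = (\<Sum>j<k. M $$ (f i, f j) * u (f j))"
    using f(1) by (simp add: sum.reindex)
  finally show "0 < (\<Sum>j<k. mat k k (\<lambda>(i, j). M $$ (f i, f j)) $$ (i, j) * (u \<circ> f) j)"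
    using semipositive_byD(4)[OF M fi] i by simp
next
  fix i j assume ij: "i < k" "j < k" "i \<noteq> j"
  then have "f i < m" "f j < m" "f i \<noteq> f j"
    using f by (auto simp: inj_on_def)
  then show "mat k k (\<lambda>(i, j). M $$ (f i, f j)) $$ (i, j) \<le> 0"
    using semipositive_byD(2)[OF M] ij by simp
qed simp

text \<open>Since \<open>u\<close> is positive, larger entries can only increase M u. This serves to
  replace the off-diagonal blocks of \<open>A\<close> by 0.\<close>

lemma semipositive_larger:
  assumes M: "semipositive_by m M u" and N: "N \<in> carrier_mat m m"
    and le: "\<And>i j. i < m \<Longrightarrow> j < m \<Longrightarrow> M $$ (i, j) \<le> N $$ (i, j)"
    and Z: "\<And>i j. i < m \<Longrightarrow> j < m \<Longrightarrow> i \<noteq> j \<Longrightarrow> N $$ (i, j) \<le> 0"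
  shows "semipositive_by m N u"
  unfolding semipositive_by_def
proof (intro conjI allI impI)
  fix i assume i: "i < m"
  have "(\<Sum>j<m. M $$ (i, j) * u j) \<le> (\<Sum>j<m. N $$ (i, j) * u j)"
    using le[OF i] semipositive_byD(3)[OF M] by (intro sum_mono mult_right_mono) (auto intro: less_imp_le)
  with semipositive_byD(4)[OF M i] show "0 < (\<Sum>j<m. N $$ (i, j) * u j)" by simp
qed (use N Z semipositive_byD(3)[OF M] in auto)

lemma semipositive_one: "semipositive_by m (1\<^sub>m m) (\<lambda>_. 1)"
proof -
  have "(\<Sum>j<m. 1\<^sub>m m $$ (i, j)) = (\<Sum>j<m. if i = j then 1 else (0::real))" if "i < m" for i
    using that by (intro sum.cong) auto
  then show ?thesis by (auto simp: semipositive_by_def)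
qed

section \<open>Linear complementarity problems\<close>

text \<open>For feasible \<open>x\<close> the dot product is a sum of non-negative terms, so it
  vanishes exactly when each term does.\<close>

lemma lcp_solution_iff:
  assumes M: "M \<in> carrier_mat m m" and q: "q \<in> carrier_vec m"
  shows "lcp_solution M q x \<longleftrightarrow> x \<in> carrier_vec m \<and> (\<forall>i<m. 0 \<le> x $ i
     \<and> q $ i \<le> (\<Sum>j<m. M $$ (i, j) * x $ j)
     \<and> (x $ i = 0 \<or> (\<Sum>j<m. M $$ (i, j) * x $ j) = q $ i))"
proof (cases "x \<in> carrier_vec m")
  case True
  let ?y = "\<lambda>i. \<Sum>j<m. M $$ (i, j) * x $ j"
  let ?g = "\<lambda>i. (?y i - q $ i) * x $ i"
  note sums = mult_mat_vec_index_sum[OF M True]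
  have "(M *\<^sub>v x - q) \<bullet> x = (\<Sum>i<m. ?g i)"
    unfolding scalar_prod_def using M q True sums by (intro sum.cong) auto
  then have "lcp_solution M q x \<longleftrightarrow> (\<forall>i<m. q $ i \<le> ?y i) \<and> (\<forall>i<m. 0 \<le> x $ i) \<and> (\<Sum>i<m. ?g i) = 0"
    using M q True sums by (simp add: lcp_solution_def less_eq_vec_def)
  also have "\<dots> \<longleftrightarrow> (\<forall>i<m. q $ i \<le> ?y i) \<and> (\<forall>i<m. 0 \<le> x $ i) \<and> (\<forall>i\<in>{..<m}. ?g i = 0)"
    by (intro conj_cong refl sum_nonneg_eq_0_iff) simp_all
  finally show ?thesis using True by auto
qed (use M in \<open>simp add: lcp_solution_def\<close>)

text \<open>Otherwise x - y has an index \<open>i\<close> where it and its image under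
  \<open>M\<close> are both negative. There y_i > x_i, which is non-negative, so complementarity
  gives (M y)_i = q_i, at most (M x)_i, a contradiction.\<close>

lemma semipositive_lcp_le:
  assumes M: "semipositive_by m M u" and q: "q \<in> carrier_vec m"
    and x: "lcp_solution M q x" and y: "lcp_solution M q y" and k: "k < m"
  shows "y $ k \<le> x $ k"
proof (rule ccontr)
  note lcp = lcp_solution_iff[OF semipositive_byD(1)[OF M] q]
  assume "\<not> y $ k \<le> x $ k"
  then obtain i where i: "i < m" "x $ i < y $ i"
    and neg: "(\<Sum>j<m. M $$ (i, j) * (x $ j - y $ j)) < 0"
    using semipositive_negative_index[OF M k, of "\<lambda>i. x $ i - y $ i"] by force
  have "y $ i \<noteq> 0" using x i unfolding lcp by force
  then have "(\<Sum>j<m. M $$ (i, j) * y $ j) = q $ i" using y i unfolding lcp by auto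
  moreover have "q $ i \<le> (\<Sum>j<m. M $$ (i, j) * x $ j)" using x i unfolding lcp by auto
  ultimately show False using neg by (simp add: algebra_simps sum_subtractf)
qed

text \<open>A Knaster-Tarski argument: the infimum of all \<open>y\<close> with f y \<le> y is a
  fixed point of the monotone map \<open>f\<close>.\<close>

lemma semipositive_lcp_exists:
  assumes M: "semipositive_by m M u" and q: "q \<in> carrier_vec m"
  shows "\<exists>x. lcp_solution M q x"
proof -
  define row where "row y i = (\<Sum>j\<in>{..<m} - {i}. M $$ (i, j) * y j)" for y :: "nat \<Rightarrow> real" and i
  have row: "(\<Sum>j<m. M $$ (i, j) * y j) = M $$ (i, i) * y i + row y i" if "i < m" for y i
    unfolding row_def using that by (simp add: sum.remove)
  \<comment> \<open>The projected Jacobi map. As the diagonal is positive, \<open>P\<close> is the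
    set of feasible vectors, and fixed points of \<open>f\<close> are the solutions of the
    complementarity problem.\<close>
  define f where "f y i = max 0 ((q $ i - row y i) / M $$ (i, i))" for y i
  define P where "P = {y. \<forall>i<m. f y i \<le> y i}"
  have f_mono: "f y i \<le> f z i" if "i < m" "\<And>j. j < m \<Longrightarrow> y j \<le> z j" for y z i
  proof -
    \<comment> \<open>Off-diagonal entries are non-positive, so \<open>row\<close> reverses the
      order and \<open>f\<close> preserves it.\<close>
    have "row z i \<le> row y i"
      unfolding row_def using that semipositive_byD(2)[OF M]
      by (intro sum_mono mult_left_mono_neg) auto
    then have "(q $ i - row y i) / M $$ (i, i) \<le> (q $ i - row z i) / M $$ (i, i)"
      using semipositive_diag_pos[OF M that(1)] by (intro divide_right_mono) auto
    then show ?thesis unfolding f_def by linarith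
  qed
  have P_nonneg: "0 \<le> y i" if "y \<in> P" "i < m" for y i
  proof -
    have "0 \<le> f y i" by (simp add: f_def)
    also have "\<dots> \<le> y i" using that by (auto simp: P_def)
    finally show ?thesis .
  qed
  obtain b where b: "b \<in> P"
  proof
    let ?M = "\<lambda>i. \<Sum>j<m. M $$ (i, j) * u j"
    \<comment> \<open>A feasible vector is a multiple of \<open>u\<close> large enough that c (M
      u)_i dominates \<bar>q_i\<bar> for all \<open>i\<close>. The sum bounds each quotient and also
      makes sense for m = 0.\<close>
    define c where "c = (\<Sum>i<m. \<bar>q $ i\<bar> / ?M i)"
    have nonneg: "0 \<le> \<bar>q $ i\<bar> / ?M i" if "i < m" for i
      using semipositive_byD(4)[OF M that] by (intro divide_nonneg_pos) auto
    then have c: "0 \<le> c" unfolding c_def by (intro sum_nonneg) auto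
    show "(\<lambda>i. c * u i) \<in> P" unfolding P_def
    proof (intro CollectI allI impI)
      fix i assume i: "i < m"
      have "\<bar>q $ i\<bar> / ?M i \<le> c"
        unfolding c_def using nonneg i
        by (intro member_le_sum[of i _ "\<lambda>i. \<bar>q $ i\<bar> / ?M i"]) auto
      then have "\<bar>q $ i\<bar> \<le> c * ?M i"
        using semipositive_byD(4)[OF M i] by (simp add: pos_divide_le_eq)
      also have "\<dots> = (\<Sum>j<m. M $$ (i, j) * (c * u j))"
        by (simp add: sum_distrib_left algebra_simps)
      also have "\<dots> = M $$ (i, i) * (c * u i) + row (\<lambda>i. c * u i) i"
        using i by (rule row)
      finally have "(q $ i - row (\<lambda>i. c * u i) i) / M $$ (i, i) \<le> c * u i"
        using semipositive_diag_pos[OF M i] by (simp add: pos_divide_le_eq algebra_simps)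
      then show "f (\<lambda>i. c * u i) i \<le> c * u i"
        using c semipositive_byD(3)[OF M i] by (simp add: f_def)
    qed
  qed
  define x where "x i = (INF y\<in>P. y i)" for i
  have bdd: "bdd_below ((\<lambda>y. y i) ` P)" if "i < m" for i
    using P_nonneg that by (intro bdd_belowI[of _ 0]) auto
  have x_le: "x i \<le> y i" if "y \<in> P" "i < m" for y i
    unfolding x_def using that bdd by (intro cINF_lower) auto
  have f_le: "f x i \<le> x i" if "i < m" for i
  proof -
    have "f x i \<le> y i" if "y \<in> P" for y
      using f_mono[OF \<open>i < m\<close>, of x y] x_le[OF that] that \<open>i < m\<close> by (force simp: P_def)
    then show ?thesis unfolding x_def[of i] using b by (intro cINF_greatest) auto
  qed
  \<comment> \<open>Monotonicity carries f x \<le> x over to f (f x) \<le> f x; as \<open>x\<close>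
    is a lower bound of \<open>P\<close>, the reverse inequality x \<le> f x follows.\<close>
  have "f x \<in> P" unfolding P_def using f_mono f_le by blast
  then have fix_f: "f x i = x i" if "i < m" for i
    using x_le[of "f x" i] f_le that by (intro antisym) auto
  have "lcp_solution M q (vec m x)"
    unfolding lcp_solution_iff[OF semipositive_byD(1)[OF M] q]
  proof (intro conjI allI impI)
    fix i assume i: "i < m"
    note d = semipositive_diag_pos[OF M i]
    have sum: "(\<Sum>j<m. M $$ (i, j) * vec m x $ j) = M $$ (i, i) * x i + row x i"
      using row[OF i, of x] by simp
    have le: "(q $ i - row x i) / M $$ (i, i) \<le> x i" and x0: "0 \<le> x i"
      and cases: "x i = 0 \<or> x i = (q $ i - row x i) / M $$ (i, i)"
      using fix_f[OF i] unfolding f_def by linarith+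
    show "0 \<le> vec m x $ i" using x0 i by simp
    show "q $ i \<le> (\<Sum>j<m. M $$ (i, j) * vec m x $ j)"
      unfolding sum using le d by (simp add: pos_divide_le_eq algebra_simps)
    show "vec m x $ i = 0 \<or> (\<Sum>j<m. M $$ (i, j) * vec m x $ j) = q $ i"
      unfolding sum using cases d i by (auto simp: field_simps)
  qed simp
  then show ?thesis ..
qed

lemma semipositive_lcp_unique_solution:
  assumes M: "semipositive_by m M u" and q: "q \<in> carrier_vec m"
  shows "\<exists>!x. lcp_solution M q x"
proof -
  have "x = y" if "lcp_solution M q x" "lcp_solution M q y" for x y
    using that semipositive_lcp_le[OF M q that] semipositive_lcp_le[OF M q that(2,1)]
    unfolding lcp_solution_iff[OF semipositive_byD(1)[OF M] q]
    by (intro eq_vecI antisym) auto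
  then show ?thesis using semipositive_lcp_exists[OF M q] by blast
qed

section \<open>The spike decomposition\<close>

lemma block_index_less:
  assumes "i < r" "p < n"
  shows "i * n + p < r * (n::nat)"
proof -
  have "i * n + p < Suc i * n" using assms(2) by simp
  also have "\<dots> \<le> r * n" using assms(1) by (intro mult_right_mono) auto
  finally show ?thesis .
qed

lemma block_index_div_mod:
  assumes "k < r * (n::nat)"
  shows "k div n < r" "k mod n < n" "k div n * n + k mod n = k"
proof -
  have "0 < n" using assms by (cases n) auto
  then show "k div n < r" "k mod n < n" "k div n * n + k mod n = k"
    using assms by (auto simp: less_mult_imp_div_less)
qed

text \<open>Removing the first block shifts indices by \<open>n\<close>, which lowers the quotient
  by one and keeps the remainder.\<close>

lemma diag_block_mat_index:
  assumes "\<And>B. B \<in> set Bs \<Longrightarrow> B \<in> carrier_mat n n" "k < length Bs * n" "l < length Bs * n"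
  shows "diag_block_mat Bs $$ (k, l) =
    (if k div n = l div n then (Bs ! (k div n)) $$ (k mod n, l mod n) else 0)"
  using assms
proof (induction Bs arbitrary: k l)
  case (Cons B Bs)
  have B: "B \<in> carrier_mat n n" using Cons.prems(1) by simp
  have "map dim_row Bs = replicate (length Bs) n" "map dim_col Bs = replicate (length Bs) n"
    using Cons.prems(1) by (auto simp: map_replicate_const[symmetric])
  then have dims: "dim_row (diag_block_mat Bs) = length Bs * n" "dim_col (diag_block_mat Bs) = length Bs * n"
    by (simp_all add: dim_diag_block_mat sum_list_replicate)
  have n: "0 < n" using Cons.prems(2) by (cases n) auto
  have IH: "\<not> k < n \<Longrightarrow> \<not> l < n \<Longrightarrow> diag_block_mat Bs $$ (k - n, l - n) =
    (if (k - n) div n = (l - n) div n then (Bs ! ((k - n) div n)) $$ ((k - n) mod n, (l - n) mod n) else 0)"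
    using Cons by (intro Cons.IH) auto
  have *: "j div n = Suc ((j - n) div n)" "j mod n = (j - n) mod n" if "\<not> j < n" for j
    using that n by (auto simp: le_div_geq le_mod_geq not_less)
  show ?case
    using Cons.prems(2,3) B dims n IH by (auto simp: Let_def *)
qed simp

lemma mat_block_index:
  "p < n \<Longrightarrow> q < n \<Longrightarrow> mat_block n A i j $$ (p, q) = A $$ (i * n + p, j * n + q)"
  by (simp add: mat_block_def)

section \<open>Diagonal blocks and the block diagonal factor D\<close>

lemma semipositive_diagonal_block:
  assumes A: "semipositive_by (r * n) A u" and i: "i < r"
  shows "semipositive_by n (diagonal_block n A i) (\<lambda>p. u (i * n + p))"
  using semipositive_principal[OF A, of "\<lambda>p. i * n + p" n] block_index_less[OF i]
  by (auto simp: diagonal_block_def mat_block_def comp_def inj_on_def)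

lemma semipositive_spike_diag:
  assumes A: "semipositive_by (r * n) A u"
  shows "semipositive_by (r * n) (spike_diag r n A) u"
proof -
  let ?Bs = "map (diagonal_block n A) [0..<r]"
  have Bs: "B \<in> carrier_mat n n" if "B \<in> set ?Bs" for B
    using that by (auto simp: diagonal_block_def mat_block_def)
  have "map dim_row ?Bs = replicate r n" "map dim_col ?Bs = replicate r n"
    by (auto simp: diagonal_block_def mat_block_def intro!: nth_equalityI)
  then have C: "spike_diag r n A \<in> carrier_mat (r * n) (r * n)"
    by (auto simp: spike_diag_def dim_diag_block_mat sum_list_replicate)
  have D: "spike_diag r n A $$ (k, l) = (if k div n = l div n then A $$ (k, l) else 0)"
    if "k < r * n" "l < r * n" for k l
  proof -
    note kl = block_index_div_mod[OF that(1)] block_index_div_mod[OF that(2)]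
    have "spike_diag r n A $$ (k, l) =
        (if k div n = l div n then (?Bs ! (k div n)) $$ (k mod n, l mod n) else 0)"
      unfolding spike_diag_def using that by (intro diag_block_mat_index Bs) auto
    moreover have "l div n * n + k mod n = k" if "k div n = l div n"
      using kl(3) that by simp
    ultimately show ?thesis
      using kl by (auto simp: diagonal_block_def mat_block_index)
  qed
  show ?thesis
  proof (rule semipositive_larger[OF A C])
    fix k l assume kl: "k < r * n" "l < r * n"
    have "k \<noteq> l" if "k div n \<noteq> l div n" using that by auto
    then show "A $$ (k, l) \<le> spike_diag r n A $$ (k, l)"
      using D[OF kl] semipositive_byD(2)[OF A kl] by auto
    show "spike_diag r n A $$ (k, l) \<le> 0" if "k \<noteq> l"
      using D[OF kl] semipositive_byD(2)[OF A kl that] by auto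
  qed
qed

text \<open>The \<open>THE\<close> in \<open>spike_rhs\<close> is meaningful because D is
  nonsingular: the inverse of D provides both existence and uniqueness.\<close>

lemma spike_rhs_carrier:
  assumes A: "semipositive_by (r * n) A u" and F: "F \<in> carrier_vec (r * n)"
  shows "spike_rhs r n A F \<in> carrier_vec (r * n)"
proof -
  let ?D = "spike_diag r n A" and ?N = "r * n"
  note D = semipositive_spike_diag[OF A]
  note C = semipositive_byD(1)[OF D] and inv = semipositive_mat_inv(1-3)[OF D]
  have "\<exists>!G. G \<in> carrier_vec ?N \<and> ?D *\<^sub>v G = F"
  proof
    show "mat_inv ?D *\<^sub>v F \<in> carrier_vec ?N \<and> ?D *\<^sub>v (mat_inv ?D *\<^sub>v F) = F"
      using C inv F by (simp flip: assoc_mult_mat_vec)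
  next
    fix G assume G: "G \<in> carrier_vec ?N \<and> ?D *\<^sub>v G = F"
    then have "mat_inv ?D *\<^sub>v F = (mat_inv ?D * ?D) *\<^sub>v G"
      using C inv(3) by auto
    then show "G = mat_inv ?D *\<^sub>v F" using G inv(2) by simp
  qed
  from theI'[OF this] show ?thesis by (simp add: spike_rhs_def)
qed

text \<open>This is S = D^-1 A read blockwise. The identity blocks come from the diagonal and the
  zero blocks from block tridiagonality, so one formula covers all cases.\<close>

lemma spike_block_eq:
  assumes A: "semipositive_by (r * n) A u" and T: "block_tridiagonal r n \<beta> A" and ij: "i < r" "j < r"
  shows "spike_block r n A i j = mat_inv (diagonal_block n A i) * mat_block n A i j"
proof -
  note inv = semipositive_mat_inv[OF semipositive_diagonal_block[OF A ij(1)]]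
  consider "i = j" | "j = Suc i" | "i = Suc j" | "Suc i < j \<or> Suc j < i" by linarith
  then show ?thesis
  proof cases
    case 4
    then have "mat_block n A i j = 0\<^sub>m n n" using T ij by (auto simp: block_tridiagonal_def)
    then show ?thesis using 4 inv(3) by (auto simp: spike_block_def)
  qed (use inv(2) ij in \<open>auto simp: spike_block_def upper_spike_def upper_coupling_def
         lower_spike_def lower_coupling_def diagonal_block_def\<close>)
qed

text \<open>Off the diagonal, S has entries of an identity block or sums of non-negative entries of
  an inverse block times non-positive entries of \<open>A\<close>. The witness stays
  \<open>u\<close>, since S u = D^-1 A u = D^-1 1.\<close>

lemma semipositive_spike_mat:
  assumes A: "semipositive_by (r * n) A u" and T: "block_tridiagonal r n \<beta> A"
    and u: "\<And>k. k < r * n \<Longrightarrow> (\<Sum>l<r * n. A $$ (k, l) * u l) = 1"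
  shows "semipositive_by (r * n) (spike_mat r n A) u"
proof -
  let ?S = "spike_mat r n A" and ?I = "\<lambda>i. mat_inv (diagonal_block n A i)"
  note block = semipositive_diagonal_block[OF A]
  have S: "?S $$ (k, l) = (\<Sum>q<n. ?I (k div n) $$ (k mod n, q) * A $$ (k div n * n + q, l))"
    if "k < r * n" "l < r * n" for k l
  proof -
    note kl = block_index_div_mod[OF that(1)] block_index_div_mod[OF that(2)]
    have "mat_block n A (k div n) (l div n) \<in> carrier_mat n n" by (simp add: mat_block_def)
    then have "?S $$ (k, l) =
        (\<Sum>q<n. ?I (k div n) $$ (k mod n, q) * mat_block n A (k div n) (l div n) $$ (q, l mod n))"
      using mult_mat_index_sum[OF semipositive_mat_inv(3)[OF block[OF kl(1)]] _ kl(2,5)]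
      by (simp add: spike_mat_def that spike_block_eq[OF A T kl(1,4)])
    then show ?thesis using kl by (simp add: mat_block_index)
  qed
  show ?thesis
    unfolding semipositive_by_def
  proof (intro conjI allI impI)
    show "?S \<in> carrier_mat (r * n) (r * n)" by (simp add: spike_mat_def)
  next
    fix k l assume kl: "k < r * n" "l < r * n" "k \<noteq> l"
    note k = block_index_div_mod[OF kl(1)] and l = block_index_div_mod[OF kl(2)]
    show "?S $$ (k, l) \<le> 0"
    proof (cases "k div n = l div n")
      case True
      then have "k mod n \<noteq> l mod n" using k(3) l(3) kl(3) by metis
      then show ?thesis using kl True k l by (simp add: spike_mat_def spike_block_def)
    next
      case False
      \<comment> \<open>Column \<open>l\<close> lies in another block than these rows, so only
        off-diagonal entries of \<open>A\<close> occur.\<close>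
      have "A $$ (k div n * n + q, l) \<le> 0" if "q < n" for q
      proof (rule semipositive_byD(2)[OF A block_index_less[OF k(1) that] kl(2)])
        have "(k div n * n + q) div n = k div n" using that by simp
        with False show "k div n * n + q \<noteq> l" by auto
      qed
      then show ?thesis
        using semipositive_mat_inv(4)[OF block[OF k(1)] k(2)]
        unfolding S[OF kl(1,2)] by (intro sum_nonpos mult_nonneg_nonpos) auto
    qed
  next
    fix k assume k: "k < r * n"
    note k' = block_index_div_mod[OF k]
    note inv = semipositive_mat_inv[OF block[OF k'(1)]]
    show "0 < u k" by (rule semipositive_byD(3)[OF A k])
    \<comment> \<open>Summing over \<open>l\<close> first produces the entries of A u, all equal to
      1; a row sum of the inverse diagonal block remains.\<close>
    have "(\<Sum>l<r * n. ?S $$ (k, l) * u l) =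
        (\<Sum>l<r * n. \<Sum>q<n. ?I (k div n) $$ (k mod n, q) * (A $$ (k div n * n + q, l) * u l))"
      using k by (intro sum.cong) (auto simp: S sum_distrib_right mult.assoc)
    also have "\<dots> = (\<Sum>q<n. \<Sum>l<r * n. ?I (k div n) $$ (k mod n, q) * (A $$ (k div n * n + q, l) * u l))"
      by (rule sum.swap)
    also have "\<dots> = (\<Sum>q<n. ?I (k div n) $$ (k mod n, q))"
      using u block_index_less[OF k'(1)] by (simp flip: sum_distrib_left)
    also have "\<dots> > 0"
      using semipositive_byD(2)[OF block[OF k'(1)]] inv(4)
      by (intro inverse_row_sum_pos(1)[OF semipositive_byD(1)[OF block[OF k'(1)]] inv(3,1) _ _ k'(2)])
    finally show "0 < (\<Sum>l<r * n. ?S $$ (k, l) * u l)" .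
  qed
qed

lemma semipositive_submatrix:
  assumes M: "semipositive_by m M u"
  shows "semipositive_by (card {i. i < m \<and> i \<in> I}) (submatrix M I I) (u \<circ> pick I)"
proof -
  let ?c = "card {i. i < m \<and> i \<in> I}"
  \<comment> \<open>Counting the elements of \<open>I\<close> below an index inverts
    \<open>pick I\<close>. For finite \<open>I\<close> this is available at positions below
    \<open>card I\<close>, hence the bound on \<open>?c\<close>.\<close>
  have "inj_on (pick I) {..<?c}"
  proof (cases "finite I")
    case True
    have "?c \<le> card I" using True by (intro card_mono) auto
    then show ?thesis
      by (intro inj_on_inverseI[of _ "\<lambda>k. card {a \<in> I. a < k}"]) (simp add: card_pick_le)
  next
    case False
    then show ?thesis
      by (intro inj_on_inverseI[of _ "\<lambda>k. card {a \<in> I. a < k}"]) (simp add: card_pick_inf)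
  qed
  moreover have "pick I ` {..<?c} \<subseteq> {..<m}" using pick_le by auto
  ultimately show ?thesis
    using semipositive_principal[OF M] semipositive_byD(1)[OF M] by (simp add: submatrix_def)
qed

text \<open>This matches the dimension of \<open>remaining_rhs\<close> with that of the identity
  matrix \<open>remaining_mat\<close>.\<close>

lemma card_middle_indices:
  assumes "2 * \<beta> \<le> n"
  shows "card (middle_indices r n \<beta>) = r * (n - 2 * \<beta>)"
proof -
  have "bij_betw (\<lambda>(i, p). i * n + p) ({..<r} \<times> {\<beta>..<n - \<beta>}) (middle_indices r n \<beta>)"
    by (rule bij_betw_byWitness[where f' = "\<lambda>k. (k div n, k mod n)"])
      (auto simp: middle_indices_def block_index_less block_index_div_mod)
  from bij_betw_same_card[OF this] show ?thesis
    by (simp add: card_cartesian_product mult_2)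
qed

theorem theorem3p4:
  fixes r n \<beta> :: nat and A :: "real mat" and F :: "real vec"
  assumes "A \<in> carrier_mat (r * n) (r * n)" and "F \<in> carrier_vec (r * n)"
    and "M_matrix A"
    and "block_tridiagonal r n \<beta> A"
  shows "(\<exists>!X. lcp_solution (reduced_spike_mat r n \<beta> A) (reduced_spike_rhs r n \<beta> A F) X)
    \<and> (\<forall>X. lcp_solution (reduced_spike_mat r n \<beta> A) (reduced_spike_rhs r n \<beta> A F) X \<longrightarrow>
          (\<exists>!Y. lcp_solution (remaining_mat r n \<beta>) (remaining_rhs r n \<beta> A F X) Y))"
proof (intro conjI allI impI)
  obtain u where A: "semipositive_by (r * n) A u"
    and u: "\<And>k. k < r * n \<Longrightarrow> (\<Sum>l<r * n. A $$ (k, l) * u l) = 1"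
    using M_matrix_semipositive assms(1,3) by metis
  have "semipositive_by (r * n) (spike_mat r n A) u"
    using A assms(4) u by (rule semipositive_spike_mat)
  note S = semipositive_submatrix[OF this, of "reduced_indices r n \<beta>"]
  have "reduced_spike_rhs r n \<beta> A F \<in> carrier_vec (card {i. i < r * n \<and> i \<in> reduced_indices r n \<beta>})"
    using spike_rhs_carrier[OF A assms(2)] by (simp add: reduced_spike_rhs_def subvector_def)
  then show "\<exists>!X. lcp_solution (reduced_spike_mat r n \<beta> A) (reduced_spike_rhs r n \<beta> A F) X"
    unfolding reduced_spike_mat_def by (rule semipositive_lcp_unique_solution[OF S])
next
  fix X
  \<comment> \<open>With the identity matrix the problem is uniquely solvable for every right-hand
    side of the right dimension, so it remains to compute the dimension of
    \<open>remaining_rhs\<close>.\<close>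
  have "2 * \<beta> \<le> n" using assms(4) by (simp add: block_tridiagonal_def)
  moreover have "{i. i < r * n \<and> i \<in> middle_indices r n \<beta>} = middle_indices r n \<beta>"
    by (auto simp: middle_indices_def)
  ultimately have "remaining_rhs r n \<beta> A F X \<in> carrier_vec (r * (n - 2 * \<beta>))"
    by (simp add: remaining_rhs_def Let_def subvector_def card_middle_indices)
  then show "\<exists>!Y. lcp_solution (remaining_mat r n \<beta>) (remaining_rhs r n \<beta> A F X) Y"
    unfolding remaining_mat_def by (rule semipositive_lcp_unique_solution[OF semipositive_one])
qed

end
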